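(* Let $\lambda_1,\lambda_2>0$, let $S=\{S(t)\}_{t\ge 0}$ be a Lévy subordinator with Laplace exponent $\psi$, and let $\{\mathcal N_1(t,\lambda_1)\}_{t\ge0}$, $\{\mathcal N_2(t,\lambda_2)\}_{t\ge0}$ be independent homogeneous Poisson processes with intensities $\lambda_1,\lambda_2$, independent of $S$. Suppose that shocks of types 1 and 2 arrive according to the process $$N(t)=\big(\mathcal N_1(S(t),\lambda_1),\,\mathcal N_2(S(t),\lambda_2)\big),\qquad t\ge0.$$ Let $L$ be a random threshold with values in $\mathbb N=\{1,2,\dots\}$, independent of these processes, with geometric distribution of parameter $p\in(0,1]$, i.e. $\overline q_k=\mathbb P(L>k)=(1-p)^k$ for $k=0,1,2,\dots$. Let $$T=\inf\{t\ge 0:\ \mathcal N_1(S(t),\lambda_1)+\mathcal N_2(S(t),\lambda_2)= L\}$$ be the failure time of the system. Then the reliability function of $T$ is $$\overline F_T(t)=e^{-t\,\psi((\lambda_1+\lambda_2)p)}.$$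
   Context: A Lévy subordinator $S$ is a non-decreasing Lévy process with Laplace transform $\mathbb E(e^{-uS(t)})=e^{-t\psi(u)}$, $u\ge0$, where the Laplace exponent is $\psi(u)=\eta u+\int_0^\infty(1-e^{-ux})\,\nu(dx)$, with drift $\eta\ge0$ and non-negative Lévy measure $\nu$ on the positive half-line satisfying $\int_0^\infty\min\{x,1\}\,\nu(dx)<\infty$ and $\nu([0,\infty))=\infty$ (so that sample paths are a.s. strictly increasing). The reliability function of $T$ is $\overline F_T(t)=\mathbb P(T>t)$, and in the model it is expressed as $\overline F_T(t)=\sum_{k=0}^\infty \overline q_k\sum_{x_1=0}^{k}\mathbb P\big(\mathcal N_1(S(t),\lambda_1)=x_1,\ \mathcal N_2(S(t),\lambda_2)=k-x_1\big)$, with $\overline q_0=1$.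
   Formalization: The failure time T is taken as the first time the total number of shocks is at least L, instead of equal to L, because S jumps and the total can skip the value L, which makes the claimed formula false for the literal definition. *)

theory Defs
  imports "HOL-Probability.Probability"
begin

text \<open>
  Stochastic processes are functions on time \<open>real\<close>, of which only the values at times
  \<open>t \<ge> 0\<close> matter.
\<close>

definition cadlag_on_nonneg :: "(real \<Rightarrow> real) \<Rightarrow> bool" where
  "cadlag_on_nonneg f \<longleftrightarrow>
     (\<forall>t\<ge>0. (f \<longlongrightarrow> f t) (at_right t)) \<and> (\<forall>t>0. \<exists>l. (f \<longlongrightarrow> l) (at_left t))"

definition levy_process :: "'a measure \<Rightarrow> (real \<Rightarrow> 'a \<Rightarrow> real) \<Rightarrow> bool" where
  "levy_process M X \<longleftrightarrow>
     (\<forall>t\<ge>0. X t \<in> borel_measurable M) \<and>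
     (AE \<omega> in M. X 0 \<omega> = 0) \<and>
     (\<forall>(n::nat) (s :: nat \<Rightarrow> real). 0 \<le> s 0 \<and> (\<forall>i<n. s i \<le> s (Suc i)) \<longrightarrow>
        prob_space.indep_vars M (\<lambda>_. borel) (\<lambda>i \<omega>. X (s (Suc i)) \<omega> - X (s i) \<omega>) {..<n}) \<and>
     (\<forall>s\<ge>0. \<forall>h\<ge>0. distr M borel (\<lambda>\<omega>. X (s + h) \<omega> - X s \<omega>) = distr M borel (X h)) \<and>
     (\<forall>t\<ge>0. \<forall>\<epsilon>>0.
        ((\<lambda>s. measure M {\<omega> \<in> space M. \<bar>X s \<omega> - X t \<omega>\<bar> > \<epsilon>}) \<longlongrightarrow> 0) (at t within {0..})) \<and>
     (AE \<omega> in M. cadlag_on_nonneg (\<lambda>t. X t \<omega>))"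

definition laplace_exponent :: "real \<Rightarrow> real measure \<Rightarrow> real \<Rightarrow> real" where
  "laplace_exponent \<eta> \<nu> u = \<eta> * u + (LINT x:{0<..}|\<nu>. 1 - exp (- (u * x)))"

definition levy_subordinator ::
  "'a measure \<Rightarrow> (real \<Rightarrow> 'a \<Rightarrow> real) \<Rightarrow> real \<Rightarrow> real measure \<Rightarrow> bool" where
  "levy_subordinator M S \<eta> \<nu> \<longleftrightarrow>
     levy_process M S \<and>
     (AE \<omega> in M. mono_on {0..} (\<lambda>t. S t \<omega>)) \<and>
     0 \<le> \<eta> \<and>
     sets \<nu> = sets borel \<and>
     emeasure \<nu> {..0} = 0 \<and>
     (\<integral>\<^sup>+x\<in>{0<..}. ennreal (min x 1) \<partial>\<nu>) < \<infinity> \<and>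
     emeasure \<nu> {0..} = \<infinity> \<and>
     (\<forall>t\<ge>0. \<forall>u\<ge>0.
        prob_space.expectation M (\<lambda>\<omega>. exp (- (u * S t \<omega>))) = exp (- (t * laplace_exponent \<eta> \<nu> u)))"

definition poisson_process :: "'a measure \<Rightarrow> real \<Rightarrow> (real \<Rightarrow> 'a \<Rightarrow> nat) \<Rightarrow> bool" where
  "poisson_process M r N \<longleftrightarrow>
     levy_process M (\<lambda>t \<omega>. real (N t \<omega>)) \<and>
     (AE \<omega> in M. mono_on {0..} (\<lambda>t. N t \<omega>)) \<and>
     (\<forall>t\<ge>0. \<forall>k. measure M {\<omega> \<in> space M. N t \<omega> = k} = exp (- (r * t)) * (r * t) ^ k / fact k)"

text \<open>The sigma-algebras generated by a process and by a random variable, as families of events.\<close>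

definition process_events ::
  "'a measure \<Rightarrow> 'b measure \<Rightarrow> (real \<Rightarrow> 'a \<Rightarrow> 'b) \<Rightarrow> 'a set set" where
  "process_events M K X =
     sigma_sets (space M) {X t -` A \<inter> space M | t A. 0 \<le> t \<and> A \<in> sets K}"

definition variable_events :: "'a measure \<Rightarrow> 'b measure \<Rightarrow> ('a \<Rightarrow> 'b) \<Rightarrow> 'a set set" where
  "variable_events M K Y = {Y -` A \<inter> space M | A. A \<in> sets K}"

text \<open>
  Joint (mutual) independence of the two counting processes, the subordinator and the threshold.
\<close>

definition independent_inputs ::
  "'a measure \<Rightarrow> (real \<Rightarrow> 'a \<Rightarrow> nat) \<Rightarrow> (real \<Rightarrow> 'a \<Rightarrow> nat) \<Rightarrow> (real \<Rightarrow> 'a \<Rightarrow> real) \<Rightarrow> ('a \<Rightarrow> nat) \<Rightarrow> bool"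
where
  "independent_inputs M N1 N2 S L \<longleftrightarrow>
     prob_space.indep_sets M
       ((!) [process_events M (count_space UNIV) N1, process_events M (count_space UNIV) N2,
             process_events M borel S, variable_events M (count_space {1..}) L])
       {..<4}"

definition shock_process ::
  "(real \<Rightarrow> 'a \<Rightarrow> nat) \<Rightarrow> (real \<Rightarrow> 'a \<Rightarrow> nat) \<Rightarrow> (real \<Rightarrow> 'a \<Rightarrow> real) \<Rightarrow> real \<Rightarrow> 'a \<Rightarrow> nat \<times> nat" where
  "shock_process N1 N2 S t \<omega> = (N1 (S t \<omega>) \<omega>, N2 (S t \<omega>) \<omega>)"

text \<open>
  The failure time is the arrival time of the \<open>L\<close>-th shock, that is, the first time the total
  number of shocks has reached \<open>L\<close>. Where the informal definition has ``\<open>= L\<close>'', the formal one has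
  \<open>\<ge> L\<close>: a subordinator with infinite Levy measure jumps, several shocks may then arrive at the
  same instant, and the total may pass from below \<open>L\<close> to above \<open>L\<close> without ever being equal to it.
  The event that the failure time exceeds \<open>t\<close> is thus, up to a null set, the event that fewer than
  \<open>L\<close> shocks have arrived by time \<open>t\<close>. The infimum is taken in the extended reals, so it is
  \<open>\<infinity>\<close> if the system never fails.
\<close>

definition failure_time :: "(real \<Rightarrow> 'a \<Rightarrow> nat \<times> nat) \<Rightarrow> ('a \<Rightarrow> nat) \<Rightarrow> 'a \<Rightarrow> ereal" where
  "failure_time N L \<omega> = Inf {ereal t | t. 0 \<le> t \<and> fst (N t \<omega>) + snd (N t \<omega>) \<ge> L \<omega>}"

text \<open>
  The path properties above hold only almost surely, and events such as \<open>T > t\<close>, or events about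
  a counting process at a random time, are determined only up to a null set.
  Their probabilities are therefore taken in the completion.
\<close>

definition reliability_function :: "'a measure \<Rightarrow> ('a \<Rightarrow> ereal) \<Rightarrow> real \<Rightarrow> real" where
  "reliability_function M T t = measure (completion M) {\<omega> \<in> space M. T \<omega> > ereal t}"

end

theory Submission
  imports Defs
begin

text \<open>
  Replacing \<open>S t\<close> by discretizations that decrease to it makes independence usable as a countable
  sum over the grid; right-continuity of the paths then gives, in the limit, the joint law of the
  two shock counts and the threshold as a mixture of Poisson laws over the law of \<open>S t\<close>.
  By monotonicity and right-continuity, the failure time exceeds \<open>t\<close> almost surely exactly when
  fewer than \<open>L\<close> shocks have arrived by time \<open>t\<close>, so the reliability is the expectation of the
  Poisson generating function \<open>exp (- (lam1 + lam2) * p * S t)\<close>.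
\<close>

section \<open>Limits, null sets and mixtures of probabilities\<close>

lemma (in prob_space) bounded_convergence:
  fixes f :: "nat \<Rightarrow> 'a \<Rightarrow> real"
  assumes [measurable]: "\<And>n. f n \<in> borel_measurable M" "g \<in> borel_measurable M"
    and lim: "AE x in M. (\<lambda>n. f n x) \<longlonglongrightarrow> g x"
    and bound: "\<And>n. AE x in M. \<bar>f n x\<bar> \<le> B"
  shows "(\<lambda>n. expectation (f n)) \<longlonglongrightarrow> expectation g"
proof (rule integral_dominated_convergence)
  show "integrable M (\<lambda>_. B)" by simp
qed (use assms in auto)

text \<open>Almost everywhere the indicators become constant in \<open>n\<close>, so bounded
  convergence applies. This carries probabilities of discretized events over to the limiting
  event.\<close>

lemma (in prob_space) prob_tendsto:
  assumes [measurable]: "\<And>n. Measurable.pred M (P n)" "Measurable.pred M Q"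
    and ev: "AE x in M. eventually (\<lambda>n. P n x \<longleftrightarrow> Q x) sequentially"
  shows "(\<lambda>n. prob {x \<in> space M. P n x}) \<longlonglongrightarrow> prob {x \<in> space M. Q x}"
proof -
  have eq: "expectation (indicat_real {x \<in> space M. R x}) = prob {x \<in> space M. R x}"
    if "Measurable.pred M R" for R
    using that by (simp add: Bochner_Integration.integral_indicator sets.Int_space_eq2)
  have "(\<lambda>n. expectation (indicat_real {x \<in> space M. P n x}))
          \<longlonglongrightarrow> expectation (indicat_real {x \<in> space M. Q x})"
  proof (rule bounded_convergence[where B = 1])
    show "AE x in M. (\<lambda>n. indicat_real {x \<in> space M. P n x} x)
            \<longlonglongrightarrow> indicat_real {x \<in> space M. Q x} x"
      using ev
    proof eventually_elim
      case (elim x)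
      show ?case
        by (rule tendsto_eventually, rule eventually_mono[OF elim]) (auto simp: indicator_def)
    qed
  qed (auto simp: indicator_def)
  then show ?thesis by (simp add: eq)
qed

text \<open>The event given by \<open>P\<close> need not be measurable, but it differs from a
  measurable one by a null set, so the completion contains it and gives it the same measure.\<close>

lemma measure_completion_AE:
  assumes Q: "Measurable.pred M Q" and ae: "AE x in M. P x \<longleftrightarrow> Q x"
  shows "measure (completion M) {x \<in> space M. P x} = measure M {x \<in> space M. Q x}"
proof -
  have Q': "{x \<in> space M. Q x} \<in> sets M" using Q by auto
  have ae': "AE x in completion M. x \<in> {x \<in> space M. Q x} \<longleftrightarrow> x \<in> {x \<in> space M. P x}"
    using AE_completion[OF ae] by eventually_elim auto
  have "{x \<in> space M. P x} \<in> sets (completion M)"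
    by (rule completion.in_sets_AE[OF ae']) (use Q' in auto)
  then have "measure (completion M) {x \<in> space M. Q x} = measure (completion M) {x \<in> space M. P x}"
    by (intro measure_eq_AE[OF ae']) (use Q' in auto)
  then show ?thesis using Q' by simp
qed

text \<open>At each point exactly one term of the series is nonzero, and sums of nonnegative
  functions commute with the integral.\<close>

lemma nn_integral_countable_split:
  fixes J :: "'a \<Rightarrow> nat"
  assumes [measurable]: "J \<in> M \<rightarrow>\<^sub>M count_space UNIV" "\<And>j. h j \<in> borel_measurable M"
  shows "(\<integral>\<^sup>+x. h (J x) x \<partial>M) = (\<Sum>j. \<integral>\<^sup>+x. h j x * indicator {x \<in> space M. J x = j} x \<partial>M)"
proof -
  have "(\<integral>\<^sup>+x. h (J x) x \<partial>M) = (\<integral>\<^sup>+x. (\<Sum>j. h j x * indicator {x \<in> space M. J x = j} x) \<partial>M)"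
  proof (rule nn_integral_cong)
    fix x assume "x \<in> space M"
    then have "(\<Sum>j. h j x * indicator {x \<in> space M. J x = j} x) = (\<Sum>j\<in>{J x}. h j x)"
      by (subst suminf_finite[of "{J x}"]) auto
    then show "h (J x) x = (\<Sum>j. h j x * indicator {x \<in> space M. J x = j} x)" by simp
  qed
  then show ?thesis by (subst (asm) nn_integral_suminf) auto
qed

text \<open>Total probability over the values of \<open>J\<close>: \<open>c j\<close> acts as the
  conditional probability of \<open>P j\<close> given \<open>J = j\<close>. Splitting both sides
  over \<open>J\<close> turns the random index into a fixed one, term by term.\<close>

lemma (in prob_space) prob_mixture:
  fixes J :: "'a \<Rightarrow> nat"
  assumes [measurable]: "J \<in> M \<rightarrow>\<^sub>M count_space UNIV" "\<And>j. Measurable.pred M (P j)"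
    and c: "\<And>j. 0 \<le> c j" "\<And>j. c j \<le> 1"
    and eq: "\<And>j. prob {x \<in> space M. J x = j \<and> P j x} = prob {x \<in> space M. J x = j} * c j"
  shows "prob {x \<in> space M. P (J x) x} = expectation (\<lambda>x. c (J x))"
proof -
  have [measurable]: "Measurable.pred M (\<lambda>x. P (J x) x)"
    by (rule measurable_compose_countable) auto
  have "ennreal (prob {x \<in> space M. P (J x) x})
      = (\<integral>\<^sup>+x. (\<lambda>j. indicator {x \<in> space M. P j x}) (J x) x \<partial>M)"
  proof -
    have "ennreal (prob {x \<in> space M. P (J x) x}) = (\<integral>\<^sup>+x. indicator {x \<in> space M. P (J x) x} x \<partial>M)"
      by (simp add: emeasure_eq_measure)
    also have "\<dots> = (\<integral>\<^sup>+x. (\<lambda>j. indicator {x \<in> space M. P j x}) (J x) x \<partial>M)"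
      by (intro nn_integral_cong) (simp add: indicator_def)
    finally show ?thesis .
  qed
  also have "\<dots> = (\<Sum>j. \<integral>\<^sup>+x. indicator {x \<in> space M. P j x} x * indicator {x \<in> space M. J x = j} x \<partial>M)"
    by (rule nn_integral_countable_split) auto
  also have "\<dots> = (\<Sum>j. ennreal (prob {x \<in> space M. J x = j \<and> P j x}))"
  proof (rule suminf_cong)
    fix j
    have "(\<integral>\<^sup>+x. indicator {x \<in> space M. P j x} x * indicator {x \<in> space M. J x = j} x \<partial>M)
        = (\<integral>\<^sup>+x. indicator {x \<in> space M. J x = j \<and> P j x} x \<partial>M)"
      by (intro nn_integral_cong) (auto simp: indicator_def)
    then show "(\<integral>\<^sup>+x. indicator {x \<in> space M. P j x} x * indicator {x \<in> space M. J x = j} x \<partial>M)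
        = ennreal (prob {x \<in> space M. J x = j \<and> P j x})"
      by (simp add: emeasure_eq_measure)
  qed
  also have "\<dots> = (\<Sum>j. \<integral>\<^sup>+x. ennreal (c j) * indicator {x \<in> space M. J x = j} x \<partial>M)"
    by (simp add: eq c nn_integral_cmult_indicator emeasure_eq_measure ennreal_mult' mult.commute)
  also have "\<dots> = (\<integral>\<^sup>+x. (\<lambda>j _. ennreal (c j)) (J x) x \<partial>M)"
    by (rule nn_integral_countable_split[symmetric]) auto
  also have "\<dots> = ennreal (expectation (\<lambda>x. c (J x)))"
    by (subst nn_integral_eq_integral)
      (auto simp: c intro!: integrable_const_bound[where B = 1] AE_I2)
  finally show ?thesis
    by (simp add: c integral_nonneg_AE)
qed

lemma (in prob_space) independent_inputsD:
  assumes "independent_inputs M N1 N2 S L"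
    and "A \<in> process_events M (count_space UNIV) N1" "B \<in> process_events M (count_space UNIV) N2"
    and "C \<in> process_events M borel S" "D \<in> variable_events M (count_space {1..}) L"
  shows "prob (A \<inter> B \<inter> C \<inter> D) = prob A * prob B * prob C * prob D"
proof -
  have 4: "{..<4} = {0, 1, 2, 3::nat}" by auto
  have "prob (\<Inter>j\<in>{..<4}. [A, B, C, D] ! j) = (\<Prod>j\<in>{..<4}. prob ([A, B, C, D] ! j))"
    by (rule indep_setsD[OF assms(1)[unfolded independent_inputs_def]])
      (use assms(2-) in \<open>auto simp: 4\<close>)
  then show ?thesis by (simp add: 4 Int_assoc mult.assoc)
qed

section \<open>Discretization of a nonnegative time from the right\<close>

text \<open>Natural-number indices make a discretized random time countably valued, as the mixture
  formula requires.\<close>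

definition grid_index :: "nat \<Rightarrow> real \<Rightarrow> nat" where
  "grid_index n x = nat \<lfloor>real (Suc n) * x\<rfloor>"

text \<open>The right endpoint of the cell with index \<open>j\<close>. The \<open>+ 1\<close> puts
  it strictly to the right of every point of the cell, which is the side on which paths are
  continuous.\<close>

definition grid_point :: "nat \<Rightarrow> nat \<Rightarrow> real" where
  "grid_point n j = (real j + 1) / real (Suc n)"

lemma grid_point_nonneg: "0 \<le> grid_point n j"
  by (simp add: grid_point_def)

lemma grid_index_measurable [measurable]: "grid_index n \<in> borel \<rightarrow>\<^sub>M count_space UNIV"
  unfolding grid_index_def by measurable

lemma grid_point_bounds:
  assumes "0 \<le> x"
  shows "x < grid_point n (grid_index n x)" "grid_point n (grid_index n x) \<le> x + 1 / real (Suc n)"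
proof -
  define k where "k = real (grid_index n x)"
  have "0 \<le> real (Suc n) * x" using assms by simp
  then have k: "k = of_int \<lfloor>real (Suc n) * x\<rfloor>"
    unfolding k_def grid_index_def by (simp del: of_nat_Suc)
  have "real (Suc n) * x < k + 1" "k \<le> real (Suc n) * x"
    unfolding k by linarith+
  then show "x < grid_point n (grid_index n x)"
      "grid_point n (grid_index n x) \<le> x + 1 / real (Suc n)"
    unfolding grid_point_def k_def[symmetric] by (simp_all add: field_simps del: of_nat_Suc)
qed

text \<open>The target filter is \<open>at_right x\<close>, so that properties of a path holding
  just after \<open>x\<close> hold at the grid points for all large \<open>n\<close>.\<close>

lemma grid_point_tendsto:
  assumes "0 \<le> x"
  shows "filterlim (\<lambda>n. grid_point n (grid_index n x)) (at_right x) sequentially"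
proof -
  have "(\<lambda>n. grid_point n (grid_index n x)) \<longlonglongrightarrow> x"
  proof (rule tendsto_sandwich)
    show "(\<lambda>n. x) \<longlonglongrightarrow> x" by simp
    show "(\<lambda>n. x + 1 / real (Suc n)) \<longlonglongrightarrow> x"
      using tendsto_add[OF tendsto_const LIMSEQ_Suc[OF lim_1_over_n], of x] by simp
    show "eventually (\<lambda>n. x \<le> grid_point n (grid_index n x)) sequentially"
      using grid_point_bounds(1)[OF assms] by (intro always_eventually allI less_imp_le)
    show "eventually (\<lambda>n. grid_point n (grid_index n x) \<le> x + 1 / real (Suc n)) sequentially"
      using grid_point_bounds(2)[OF assms] by (intro always_eventually allI)
  qed
  then show ?thesis
    using grid_point_bounds(1)[OF assms]
    by (auto simp: filterlim_at intro!: always_eventually less_imp_neq[symmetric])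
qed

section \<open>Paths and the failure event\<close>

text \<open>Natural numbers at distance less than 1 are equal, so right-continuity means local
  constancy on the right.\<close>

lemma eventually_at_right_nat_const:
  fixes f :: "real \<Rightarrow> nat"
  assumes "cadlag_on_nonneg (\<lambda>t. real (f t))" "0 \<le> t"
  shows "eventually (\<lambda>s. f s = f t) (at_right t)"
proof -
  have "((\<lambda>s. real (f s)) \<longlongrightarrow> real (f t)) (at_right t)"
    using assms by (simp add: cadlag_on_nonneg_def)
  then have "eventually (\<lambda>s. dist (real (f s)) (real (f t)) < 1) (at_right t)"
    by (rule tendstoD) simp
  then show ?thesis
    by eventually_elim (auto simp: dist_real_def)
qed

text \<open>If the threshold has been reached at \<open>t\<close>, then \<open>t\<close> itself
  bounds the infimum. Otherwise the total count keeps its value for a while after \<open>t\<close>,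
  and by monotonicity it was no larger before, so the infimum stays a positive distance above
  \<open>t\<close>.\<close>

lemma failure_time_gt_iff:
  fixes S :: "real \<Rightarrow> 'a \<Rightarrow> real" and N1 N2 :: "real \<Rightarrow> 'a \<Rightarrow> nat"
  assumes S: "cadlag_on_nonneg (\<lambda>t. S t \<omega>)" "mono_on {0..} (\<lambda>t. S t \<omega>)" "S 0 \<omega> = 0"
    and N1: "cadlag_on_nonneg (\<lambda>t. real (N1 t \<omega>))" "mono_on {0..} (\<lambda>t. N1 t \<omega>)"
    and N2: "cadlag_on_nonneg (\<lambda>t. real (N2 t \<omega>))" "mono_on {0..} (\<lambda>t. N2 t \<omega>)"
    and t: "0 \<le> t"
  shows "ereal t < failure_time (shock_process N1 N2 S) L \<omega> \<longleftrightarrow>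
    N1 (S t \<omega>) \<omega> + N2 (S t \<omega>) \<omega> < L \<omega>"
proof -
  define K where "K s = N1 (S s \<omega>) \<omega> + N2 (S s \<omega>) \<omega>" for s
  have S_mono: "S r \<omega> \<le> S s \<omega>" if "0 \<le> r" "r \<le> s" for r s
    using mono_onD[OF S(2), of r s] that by auto
  have S_nonneg: "0 \<le> S s \<omega>" if "0 \<le> s" for s
    using S_mono[of 0 s] that S(3) by simp
  have K_mono: "K r \<le> K s" if "0 \<le> r" "r \<le> s" for r s
    unfolding K_def using that S_mono[OF that] S_nonneg
    by (intro add_mono mono_onD[OF N1(2)] mono_onD[OF N2(2)]) auto
  have T: "failure_time (shock_process N1 N2 S) L \<omega> = Inf {ereal s | s. 0 \<le> s \<and> L \<omega> \<le> K s}"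
    by (simp add: failure_time_def shock_process_def K_def)
  show ?thesis
  proof
    assume gt: "ereal t < failure_time (shock_process N1 N2 S) L \<omega>"
    have "\<not> L \<omega> \<le> K t"
    proof
      assume "L \<omega> \<le> K t"
      then have "failure_time (shock_process N1 N2 S) L \<omega> \<le> ereal t"
        unfolding T using t by (intro Inf_lower) auto
      with gt show False by simp
    qed
    then show "N1 (S t \<omega>) \<omega> + N2 (S t \<omega>) \<omega> < L \<omega>" by (simp add: K_def)
  next
    assume less: "N1 (S t \<omega>) \<omega> + N2 (S t \<omega>) \<omega> < L \<omega>"
    \<comment> \<open>Two nested right neighbourhoods are needed: \<open>b\<close> bounds the
      operational time on which both counts are frozen, and \<open>c\<close> bounds the calendar
      time during which \<open>S\<close> stays below \<open>b\<close>.\<close>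
    have "eventually (\<lambda>x. N1 x \<omega> + N2 x \<omega> = K t) (at_right (S t \<omega>))"
      using eventually_at_right_nat_const[OF N1(1) S_nonneg[OF t]]
        eventually_at_right_nat_const[OF N2(1) S_nonneg[OF t]]
      by eventually_elim (simp add: K_def)
    then obtain b where b: "S t \<omega> < b" "\<And>x. S t \<omega> < x \<Longrightarrow> x < b \<Longrightarrow> N1 x \<omega> + N2 x \<omega> = K t"
      unfolding eventually_at_right_field by blast
    have "((\<lambda>s. S s \<omega>) \<longlongrightarrow> S t \<omega>) (at_right t)"
      using S(1) t by (simp add: cadlag_on_nonneg_def)
    then have "eventually (\<lambda>s. S s \<omega> < b) (at_right t)"
      using b(1) by (rule order_tendstoD)
    then obtain c where c: "t < c" "\<And>s. t < s \<Longrightarrow> s < c \<Longrightarrow> S s \<omega> < b"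
      unfolding eventually_at_right_field by blast
    have const: "K s = K t" if "t < s" "s < c" for s
    \<comment> \<open>The interval up to \<open>b\<close> excludes its left end \<open>S t\<close>,
      so times at which \<open>S\<close> has not yet moved are treated separately.\<close>
    proof (cases "S s \<omega> = S t \<omega>")
      case True
      then show ?thesis by (simp add: K_def)
    next
      case False
      then have "S t \<omega> < S s \<omega>" using S_mono[of t s] that t by simp
      then show ?thesis using b(2)[of "S s \<omega>"] c(2)[OF that] by (simp add: K_def)
    qed
    \<comment> \<open>Any point strictly between \<open>t\<close> and \<open>c\<close> works; it
      turns the pointwise bound into a strict inequality for the infimum.\<close>
    define d where "d = (t + c) / 2"
    have d: "t < d" "d < c" using c(1) by (auto simp: d_def)
    have "d \<le> s" if "0 \<le> s" "L \<omega> \<le> K s" for s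
    proof (rule ccontr)
      assume "\<not> d \<le> s"
      then have "K s \<le> K d" using that by (intro K_mono) auto
      then show False using const[OF d] less that by (simp add: K_def)
    qed
    then have "ereal d \<le> failure_time (shock_process N1 N2 S) L \<omega>"
      unfolding T by (intro Inf_greatest) auto
    then show "ereal t < failure_time (shock_process N1 N2 S) L \<omega>"
      using d(1) by (meson ereal_less(2) less_ereal.simps(1) less_le_trans)
  qed
qed

section \<open>Facts extracted from the process definitions\<close>

lemma poisson_processD:
  assumes "poisson_process M r N"
  shows "\<And>t. 0 \<le> t \<Longrightarrow> N t \<in> M \<rightarrow>\<^sub>M count_space UNIV"
    and "AE \<omega> in M. cadlag_on_nonneg (\<lambda>t. real (N t \<omega>))"
    and "AE \<omega> in M. mono_on {0..} (\<lambda>t. N t \<omega>)"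
    and "\<And>t k. 0 \<le> t \<Longrightarrow>
      measure M {\<omega> \<in> space M. N t \<omega> = k} = exp (- (r * t)) * (r * t) ^ k / fact k"
proof -
  fix t :: real assume "0 \<le> t"
  then have "(\<lambda>\<omega>. real (N t \<omega>)) \<in> borel_measurable M"
    using assms by (simp add: poisson_process_def levy_process_def)
  \<comment> \<open>Measurability is given only for the real-valued embedding of the count; taking
    the floor recovers the count itself.\<close>
  then have "(\<lambda>\<omega>. nat \<lfloor>real (N t \<omega>)\<rfloor>) \<in> M \<rightarrow>\<^sub>M count_space UNIV"
    by measurable
  then show "N t \<in> M \<rightarrow>\<^sub>M count_space UNIV" by simp
qed (use assms in \<open>auto simp: poisson_process_def levy_process_def\<close>)

lemma levy_subordinatorD:
  assumes "levy_subordinator M S \<eta> \<nu>"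
  shows "\<And>t. 0 \<le> t \<Longrightarrow> S t \<in> borel_measurable M"
    and "AE \<omega> in M. cadlag_on_nonneg (\<lambda>t. S t \<omega>) \<and> mono_on {0..} (\<lambda>t. S t \<omega>) \<and> S 0 \<omega> = 0"
    and "\<And>t u. 0 \<le> t \<Longrightarrow> 0 \<le> u \<Longrightarrow> prob_space.expectation M (\<lambda>\<omega>. exp (- (u * S t \<omega>)))
      = exp (- (t * laplace_exponent \<eta> \<nu> u))"
    and "\<And>t. 0 \<le> t \<Longrightarrow> AE \<omega> in M. 0 \<le> S t \<omega>"
proof -
  show ae: "AE \<omega> in M. cadlag_on_nonneg (\<lambda>t. S t \<omega>) \<and> mono_on {0..} (\<lambda>t. S t \<omega>) \<and> S 0 \<omega> = 0"
    using assms by (auto simp: levy_subordinator_def levy_process_def)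
  fix t :: real assume t: "0 \<le> t"
  show "AE \<omega> in M. 0 \<le> S t \<omega>"
    using ae
  proof eventually_elim
    case (elim \<omega>)
    then show ?case using mono_onD[of "{0..}" "\<lambda>t. S t \<omega>" 0 t] t by auto
  qed
qed (use assms in \<open>auto simp: levy_subordinator_def levy_process_def\<close>)

section \<open>Poisson weights\<close>

definition poisson_mass :: "real \<Rightarrow> nat \<Rightarrow> real" where
  "poisson_mass x k = exp (- x) * x ^ k / fact k"

lemma poisson_mass_measurable [measurable]: "(\<lambda>x. poisson_mass x k) \<in> borel_measurable borel"
  unfolding poisson_mass_def by measurable

lemma isCont_poisson_mass: "isCont (\<lambda>x. poisson_mass (r * x) k) x"
  unfolding poisson_mass_def by (intro continuous_intros) auto

lemma poisson_mass_nonneg: "0 \<le> x \<Longrightarrow> 0 \<le> poisson_mass x k"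
  by (simp add: poisson_mass_def)

text \<open>Superposition of independent Poisson variables, which amounts to the binomial theorem
  divided by \<open>fact k\<close>.\<close>

lemma poisson_mass_convolution:
  "(\<Sum>a=0..k. poisson_mass x a * poisson_mass y (k - a)) = poisson_mass (x + y) k"
proof -
  have "fact k * (\<Sum>a=0..k. x ^ a / fact a * (y ^ (k - a) / fact (k - a))) = (x + y) ^ k"
    unfolding binomial_ring sum_distrib_left atLeast0AtMost
    by (intro sum.cong) (auto simp: binomial_fact)
  then have "(\<Sum>a=0..k. x ^ a / fact a * (y ^ (k - a) / fact (k - a))) = (x + y) ^ k / fact k"
    by (simp add: field_simps)
  moreover have "(\<Sum>a=0..k. poisson_mass x a * poisson_mass y (k - a))
      = exp (- (x + y)) * (\<Sum>a=0..k. x ^ a / fact a * (y ^ (k - a) / fact (k - a)))"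
  proof -
    have "exp (- (x + y)) = exp (- x) * exp (- y)"
      by (simp add: exp_add[symmetric])
    then show ?thesis
      by (simp add: sum_distrib_left poisson_mass_def mult_ac)
  qed
  ultimately show ?thesis by (simp add: poisson_mass_def)
qed

text \<open>The exponential series at \<open>q * x\<close>. For \<open>q = 1\<close> it says that
  the weights have total mass 1; for \<open>q = 1 - p\<close> it averages the geometric tail and
  leaves the exponent \<open>x * p\<close>.\<close>

lemma poisson_mass_generating:
  "(\<lambda>k. q ^ k * poisson_mass x k) sums exp (- (x * (1 - q)))"
proof -
  have "(\<lambda>k. exp (- x) * ((q * x) ^ k /\<^sub>R fact k)) sums (exp (- x) * exp (q * x))"
    by (intro sums_mult exp_converges)
  moreover have "exp (- x) * exp (q * x) = exp (- (x * (1 - q)))"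
    by (simp add: exp_add[symmetric] algebra_simps)
  moreover have "exp (- x) * ((q * x) ^ k /\<^sub>R fact k) = q ^ k * poisson_mass x k" for k
    by (simp add: poisson_mass_def power_mult_distrib field_simps)
  ultimately show ?thesis by simp
qed

text \<open>A single nonnegative term is at most the total mass, the generating series at 1.\<close>

lemma poisson_mass_le_1: "0 \<le> x \<Longrightarrow> poisson_mass x k \<le> 1"
  using sum_le_suminf[OF sums_summable[OF poisson_mass_generating[of 1 x]], of "{k}"]
    sums_unique[OF poisson_mass_generating[of 1 x]] by (simp add: poisson_mass_nonneg)

section \<open>Poisson counts at a random time\<close>

text \<open>
  The process at a random time need not be measurable; it is only almost everywhere equal to the
  limit of its right-sided discretizations.
\<close>

lemma ex_measurable_subordinated:
  assumes N: "poisson_process M r N" and X [measurable]: "X \<in> borel_measurable M"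
    and nonneg: "AE \<omega> in M. 0 \<le> X \<omega>"
  obtains Y where "Y \<in> M \<rightarrow>\<^sub>M count_space (UNIV :: nat set)" "AE \<omega> in M. Y \<omega> = N (X \<omega>) \<omega>"
    "AE \<omega> in M. eventually (\<lambda>n. N (grid_point n (grid_index n (X \<omega>))) \<omega> = Y \<omega>) sequentially"
proof
  define Z where "Z n \<omega> = N (grid_point n (grid_index n (X \<omega>))) \<omega>" for n \<omega>
  \<comment> \<open>\<open>lim\<close> of a sequence of measurable functions is measurable even
    where the sequence diverges, so \<open>Y\<close> is measurable everywhere and has the right
    value almost everywhere.\<close>
  define Y where "Y \<omega> = nat \<lfloor>lim (\<lambda>n. real (Z n \<omega>))\<rfloor>" for \<omega>
  have [measurable]: "Z n \<in> M \<rightarrow>\<^sub>M count_space UNIV" for n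
    unfolding Z_def
    by (rule measurable_compose_countable[OF poisson_processD(1)[OF N grid_point_nonneg]]) measurable
  show "Y \<in> M \<rightarrow>\<^sub>M count_space (UNIV :: nat set)"
    unfolding Y_def by measurable
  \<comment> \<open>The grid points approach \<open>X\<close> strictly from the right, where the
    path of \<open>N\<close> is locally constant.\<close>
  have ev: "AE \<omega> in M. eventually (\<lambda>n. Z n \<omega> = N (X \<omega>) \<omega>) sequentially"
    using nonneg poisson_processD(2)[OF N]
  proof eventually_elim
    case (elim \<omega>)
    show ?case
      using eventually_compose_filterlim[OF eventually_at_right_nat_const[OF elim(2,1)]
          grid_point_tendsto[OF elim(1)]]
      by (simp add: Z_def)
  qed
  show Y: "AE \<omega> in M. Y \<omega> = N (X \<omega>) \<omega>"
    using ev
  proof eventually_elim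
    case (elim \<omega>)
    have "(\<lambda>n. real (Z n \<omega>)) \<longlonglongrightarrow> real (N (X \<omega>) \<omega>)"
      by (rule tendsto_eventually, rule eventually_mono[OF elim]) simp
    then show ?case by (simp add: Y_def limI)
  qed
  show "AE \<omega> in M. eventually (\<lambda>n. N (grid_point n (grid_index n (X \<omega>))) \<omega> = Y \<omega>) sequentially"
    using ev Y by eventually_elim (simp add: Z_def)
qed

text \<open>Conditioning on \<open>S t\<close>: with the grid in place of \<open>S t\<close> the
  formula is exact for every \<open>n\<close>, by independence and summation over the cells, and
  both sides converge as the grid is refined. \<open>Y1\<close> and \<open>Y2\<close> are measurable
  versions of the counts at time \<open>S t\<close>.\<close>

lemma (in prob_space) joint_law_subordinated:
  assumes S: "levy_subordinator M S \<eta> \<nu>"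
    and N1: "poisson_process M lam1 N1" and N2: "poisson_process M lam2 N2"
    and L: "L \<in> M \<rightarrow>\<^sub>M count_space {1..}"
    and indep: "independent_inputs M N1 N2 S L"
    and lam: "0 < lam1" "0 < lam2" and t: "0 \<le> t"
    and Y1 [measurable]: "Y1 \<in> M \<rightarrow>\<^sub>M count_space UNIV"
    and Y2 [measurable]: "Y2 \<in> M \<rightarrow>\<^sub>M count_space UNIV"
    and ev1: "AE \<omega> in M. eventually (\<lambda>n. N1 (grid_point n (grid_index n (S t \<omega>))) \<omega> = Y1 \<omega>) sequentially"
    and ev2: "AE \<omega> in M. eventually (\<lambda>n. N2 (grid_point n (grid_index n (S t \<omega>))) \<omega> = Y2 \<omega>) sequentially"
  shows "prob {\<omega> \<in> space M. Y1 \<omega> = a \<and> Y2 \<omega> = b \<and> l < L \<omega>}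
    = expectation (\<lambda>\<omega>. poisson_mass (lam1 * S t \<omega>) a * poisson_mass (lam2 * S t \<omega>) b)
      * prob {\<omega> \<in> space M. l < L \<omega>}"
proof -
  note [measurable] = levy_subordinatorD(1)[OF S t]
    poisson_processD(1)[OF N1 grid_point_nonneg] poisson_processD(1)[OF N2 grid_point_nonneg]
  have [measurable]: "Measurable.pred M (\<lambda>\<omega>. l < L \<omega>)"
    by (rule measurable_compose[OF L]) simp
  define q where "q = prob {\<omega> \<in> space M. l < L \<omega>}"
  have q: "0 \<le> q" "q \<le> 1" by (auto simp: q_def)
  define J where "J n \<omega> = grid_index n (S t \<omega>)" for n \<omega>
  have [measurable]: "J n \<in> M \<rightarrow>\<^sub>M count_space UNIV" for n unfolding J_def by measurable
  define f where "f x = poisson_mass (lam1 * x) a * poisson_mass (lam2 * x) b" for x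
  have [measurable]: "f \<in> borel_measurable borel" unfolding f_def by measurable
  have f: "0 \<le> f x" "f x \<le> 1" if "0 \<le> x" for x
    using that lam
    by (auto simp: f_def intro!: mult_nonneg_nonneg mult_le_one poisson_mass_nonneg poisson_mass_le_1)
  define P where "P n j \<omega> \<longleftrightarrow> N1 (grid_point n j) \<omega> = a \<and> N2 (grid_point n j) \<omega> = b \<and> l < L \<omega>" for n j \<omega>
  have P [measurable]: "Measurable.pred M (P n j)" for n j unfolding P_def by measurable
  have PJ [measurable]: "Measurable.pred M (\<lambda>\<omega>. P n (J n \<omega>) \<omega>)" for n
    by (rule measurable_compose_countable) auto
  \<comment> \<open>On \<open>J n = j\<close> the random time is the deterministic
    \<open>grid_point n j\<close>, so the event splits into four, one for each independent
    input.\<close>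
  have discrete: "prob {\<omega> \<in> space M. P n (J n \<omega>) \<omega>}
      = expectation (\<lambda>\<omega>. f (grid_point n (J n \<omega>)) * q)" for n
  proof (rule prob_mixture)
    fix j
    let ?s = "grid_point n j"
    define A B C D where "A = {\<omega> \<in> space M. N1 ?s \<omega> = a}" and "B = {\<omega> \<in> space M. N2 ?s \<omega> = b}"
      and "C = {\<omega> \<in> space M. J n \<omega> = j}" and "D = {\<omega> \<in> space M. l < L \<omega>}"
    have "A \<in> process_events M (count_space UNIV) N1"
      unfolding process_events_def A_def using grid_point_nonneg[of n j]
      by (auto intro!: sigma_sets.Basic exI[of _ ?s] exI[of _ "{a}"])
    moreover have "B \<in> process_events M (count_space UNIV) N2"
      unfolding process_events_def B_def using grid_point_nonneg[of n j]
      by (auto intro!: sigma_sets.Basic exI[of _ ?s] exI[of _ "{b}"])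
    moreover have "grid_index n -` {j} \<in> sets borel"
      using measurable_sets[OF grid_index_measurable[of n], of "{j}"] by simp
    then have "C \<in> process_events M borel S"
      unfolding process_events_def C_def J_def using t
      by (auto intro!: sigma_sets.Basic exI[of _ t] exI[of _ "grid_index n -` {j}"])
    moreover have "D \<in> variable_events M (count_space {1..}) L"
      unfolding variable_events_def D_def by (auto intro!: exI[of _ "{Suc l..}"])
    ultimately have "prob (A \<inter> B \<inter> C \<inter> D) = prob A * prob B * prob C * prob D"
      by (rule independent_inputsD[OF indep])
    moreover have "prob A = poisson_mass (lam1 * ?s) a" "prob B = poisson_mass (lam2 * ?s) b"
      unfolding A_def B_def poisson_mass_def
      using poisson_processD(4)[OF N1 grid_point_nonneg] poisson_processD(4)[OF N2 grid_point_nonneg]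
      by auto
    moreover have "{\<omega> \<in> space M. J n \<omega> = j \<and> P n j \<omega>} = A \<inter> B \<inter> C \<inter> D"
      by (auto simp: A_def B_def C_def D_def P_def)
    ultimately show "prob {\<omega> \<in> space M. J n \<omega> = j \<and> P n j \<omega>}
        = prob {\<omega> \<in> space M. J n \<omega> = j} * (f ?s * q)"
      by (simp add: f_def q_def C_def D_def)
  qed (use f[OF grid_point_nonneg] q in \<open>auto intro!: mult_le_one\<close>)
  \<comment> \<open>Left side: almost surely the discretized counts eventually agree with
    \<open>Y1\<close> and \<open>Y2\<close>.\<close>
  have "(\<lambda>n. prob {\<omega> \<in> space M. P n (J n \<omega>) \<omega>})
      \<longlonglongrightarrow> prob {\<omega> \<in> space M. Y1 \<omega> = a \<and> Y2 \<omega> = b \<and> l < L \<omega>}"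
  proof (rule prob_tendsto)
    show "AE \<omega> in M. eventually (\<lambda>n. P n (J n \<omega>) \<omega> \<longleftrightarrow> Y1 \<omega> = a \<and> Y2 \<omega> = b \<and> l < L \<omega>) sequentially"
      using ev1 ev2
    proof eventually_elim
      case (elim \<omega>)
      then show ?case by eventually_elim (simp add: P_def J_def)
    qed
  qed measurable
  \<comment> \<open>Right side: the Poisson weights are continuous in time and bounded by 1.\<close>
  moreover have "(\<lambda>n. expectation (\<lambda>\<omega>. f (grid_point n (J n \<omega>)) * q))
      \<longlonglongrightarrow> expectation (\<lambda>\<omega>. f (S t \<omega>) * q)"
  proof (rule bounded_convergence[where B = 1])
    show "AE \<omega> in M. (\<lambda>n. f (grid_point n (J n \<omega>)) * q) \<longlonglongrightarrow> f (S t \<omega>) * q"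
      using levy_subordinatorD(4)[OF S t]
    proof eventually_elim
      case (elim \<omega>)
      have "isCont f (S t \<omega>)"
        unfolding f_def by (intro continuous_intros isCont_poisson_mass)
      moreover have "(\<lambda>n. grid_point n (J n \<omega>)) \<longlonglongrightarrow> S t \<omega>"
        using grid_point_tendsto[OF elim] by (simp add: J_def filterlim_at)
      ultimately have "(\<lambda>n. f (grid_point n (J n \<omega>))) \<longlonglongrightarrow> f (S t \<omega>)"
        by (rule isCont_tendsto_compose)
      then show ?case by (rule tendsto_mult_right)
    qed
    show "AE \<omega> in M. \<bar>f (grid_point n (J n \<omega>)) * q\<bar> \<le> 1" for n
      by (rule AE_I2) (simp add: abs_mult f[OF grid_point_nonneg] q mult_le_one)
  qed measurable
  then have "(\<lambda>n. prob {\<omega> \<in> space M. P n (J n \<omega>) \<omega>})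
      \<longlonglongrightarrow> expectation (\<lambda>\<omega>. f (S t \<omega>) * q)"
    by (simp only: discrete)
  ultimately have "prob {\<omega> \<in> space M. Y1 \<omega> = a \<and> Y2 \<omega> = b \<and> l < L \<omega>}
      = expectation (\<lambda>\<omega>. f (S t \<omega>) * q)"
    by (rule LIMSEQ_unique)
  then show ?thesis by (simp add: f_def q_def)
qed

section \<open>The reliability function under a geometric threshold\<close>

theorem theorem4p1:
  fixes M :: "'a measure"
    and S :: "real \<Rightarrow> 'a \<Rightarrow> real"
    and N1 N2 :: "real \<Rightarrow> 'a \<Rightarrow> nat"
    and L :: "'a \<Rightarrow> nat"
    and T :: "'a \<Rightarrow> ereal"
    and lam1 lam2 \<eta> p t :: real
    and \<nu> :: "real measure"
  assumes "prob_space M"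
    and "0 < lam1" and "0 < lam2"
    and "levy_subordinator M S \<eta> \<nu>"
    and "poisson_process M lam1 N1" and "poisson_process M lam2 N2"
    and "L \<in> measurable M (count_space {1..})"
    and "independent_inputs M N1 N2 S L"
    and "0 < p" and "p \<le> 1"
    and "\<And>k. measure M {\<omega> \<in> space M. L \<omega> > k} = (1 - p) ^ k"
    and "T = failure_time (shock_process N1 N2 S) L"
    and "0 \<le> t"
  shows "(\<lambda>k. measure M {\<omega> \<in> space M. L \<omega> > k} *
              (\<Sum>x\<^sub>1=0..k. measure (completion M)
                 {\<omega> \<in> space M. shock_process N1 N2 S t \<omega> = (x\<^sub>1, k - x\<^sub>1)}))
           sums reliability_function M T t \<and>
         reliability_function M T t = exp (- (t * laplace_exponent \<eta> \<nu> ((lam1 + lam2) * p)))"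
proof -
  interpret prob_space M by fact
  note S = assms(4) and N1 = assms(5) and N2 = assms(6) and t = \<open>0 \<le> t\<close>
  note [measurable] = levy_subordinatorD(1)[OF S t]
  have [measurable]: "Measurable.pred M (\<lambda>\<omega>. k < L \<omega>)" for k
    by (rule measurable_compose[OF assms(7)]) simp
  note nonneg = levy_subordinatorD(4)[OF S t]
  obtain Y1 where Y1 [measurable]: "Y1 \<in> M \<rightarrow>\<^sub>M count_space (UNIV :: nat set)"
    and Y1_eq: "AE \<omega> in M. Y1 \<omega> = N1 (S t \<omega>) \<omega>"
    and ev1: "AE \<omega> in M. eventually (\<lambda>n. N1 (grid_point n (grid_index n (S t \<omega>))) \<omega> = Y1 \<omega>) sequentially"
    using ex_measurable_subordinated[OF N1 _ nonneg] by auto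
  obtain Y2 where Y2 [measurable]: "Y2 \<in> M \<rightarrow>\<^sub>M count_space (UNIV :: nat set)"
    and Y2_eq: "AE \<omega> in M. Y2 \<omega> = N2 (S t \<omega>) \<omega>"
    and ev2: "AE \<omega> in M. eventually (\<lambda>n. N2 (grid_point n (grid_index n (S t \<omega>))) \<omega> = Y2 \<omega>) sequentially"
    using ex_measurable_subordinated[OF N2 _ nonneg] by auto
  \<comment> \<open>\<open>m a b\<close> is the mixed Poisson probability of \<open>a\<close> shocks
    of type 1 and \<open>b\<close> of type 2 by time \<open>t\<close>.\<close>
  define m where "m a b = expectation (\<lambda>\<omega>. poisson_mass (lam1 * S t \<omega>) a * poisson_mass (lam2 * S t \<omega>) b)" for a b
  have joint: "prob {\<omega> \<in> space M. Y1 \<omega> = a \<and> Y2 \<omega> = b \<and> l < L \<omega>} = m a b * (1 - p) ^ l" for a b l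
    using joint_law_subordinated[OF S N1 N2 assms(7,8,2,3) t Y1 Y2 ev1 ev2, of a b l] assms(11)[of l]
    by (simp add: m_def)
  have shock: "measure (completion M) {\<omega> \<in> space M. shock_process N1 N2 S t \<omega> = (a, b)} = m a b" for a b
  proof -
    have "measure (completion M) {\<omega> \<in> space M. shock_process N1 N2 S t \<omega> = (a, b)}
        = prob {\<omega> \<in> space M. Y1 \<omega> = a \<and> Y2 \<omega> = b}"
      by (rule measure_completion_AE) (use Y1_eq Y2_eq in \<open>auto simp: shock_process_def\<close>)
    \<comment> \<open>The threshold is at least 1, so \<open>0 < L\<close> may be added freely; the
      joint law at \<open>l = 0\<close> then contributes the factor
      \<open>(1 - p) ^ 0 = 1\<close>.\<close>
    also have "\<dots> = prob {\<omega> \<in> space M. Y1 \<omega> = a \<and> Y2 \<omega> = b \<and> 0 < L \<omega>}"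
      using measurable_space[OF assms(7)] by (intro arg_cong[where f = prob]) force
    finally show ?thesis by (simp add: joint)
  qed
  have [measurable]: "Measurable.pred M (\<lambda>\<omega>. Y1 \<omega> + Y2 \<omega> < L \<omega>)"
    by (rule measurable_compose_countable[where g = "\<lambda>\<omega>. Y1 \<omega> + Y2 \<omega>"]) measurable
  have R: "reliability_function M T t = prob {\<omega> \<in> space M. Y1 \<omega> + Y2 \<omega> < L \<omega>}"
    unfolding reliability_function_def
  proof (rule measure_completion_AE)
    show "AE \<omega> in M. ereal t < T \<omega> \<longleftrightarrow> Y1 \<omega> + Y2 \<omega> < L \<omega>"
      using levy_subordinatorD(2)[OF S] poisson_processD(2,3)[OF N1] poisson_processD(2,3)[OF N2] Y1_eq Y2_eq
    proof eventually_elim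
      case (elim \<omega>)
      then show ?case
        using failure_time_gt_iff[of S \<omega> N1 N2 t L] t assms(12) by simp
    qed
  qed measurable
  \<comment> \<open>Splitting by the total count \<open>k\<close> replaces the random comparison
    with \<open>L\<close> by the fixed-level event \<open>k < L\<close>, to which the joint law
    applies.\<close>
  have "(\<lambda>k. prob {\<omega> \<in> space M. Y1 \<omega> + Y2 \<omega> = k \<and> k < L \<omega>}) sums prob {\<omega> \<in> space M. Y1 \<omega> + Y2 \<omega> < L \<omega>}"
    by (rule prob_sums) auto
  moreover have "prob {\<omega> \<in> space M. Y1 \<omega> + Y2 \<omega> = k \<and> k < L \<omega>}
      = (1 - p) ^ k * (\<Sum>a=0..k. m a (k - a))" for k
  proof -
    have "prob {\<omega> \<in> space M. Y1 \<omega> + Y2 \<omega> = k \<and> k < L \<omega>}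
        = (\<Sum>a\<in>{0..k}. prob {\<omega> \<in> space M. Y1 \<omega> = a \<and> Y2 \<omega> = k - a \<and> k < L \<omega>})"
      by (rule prob_sum) auto
    then show ?thesis by (simp add: joint sum_distrib_left mult.commute)
  qed
  ultimately have sums: "(\<lambda>k. (1 - p) ^ k * (\<Sum>a=0..k. m a (k - a))) sums reliability_function M T t"
    by (simp add: R)
  have bound: "0 \<le> poisson_mass (r * x) k \<and> poisson_mass (r * x) k \<le> 1" if "0 < r" "0 \<le> x" for r x k
    using that by (simp add: poisson_mass_nonneg poisson_mass_le_1)
  \<comment> \<open>Given \<open>S t\<close>, the total count is Poisson with the added
    intensities.\<close>
  have m_sum: "(\<Sum>a=0..k. m a (k - a)) = expectation (\<lambda>\<omega>. poisson_mass ((lam1 + lam2) * S t \<omega>) k)" for k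
  proof -
    have "integrable M (\<lambda>\<omega>. poisson_mass (lam1 * S t \<omega>) a * poisson_mass (lam2 * S t \<omega>) b)" for a b
      by (rule integrable_const_bound[where B = 1])
        (use nonneg bound assms(2,3) in \<open>auto simp: abs_mult intro!: mult_le_one\<close>)
    then have "(\<Sum>a=0..k. m a (k - a))
        = expectation (\<lambda>\<omega>. \<Sum>a=0..k. poisson_mass (lam1 * S t \<omega>) a * poisson_mass (lam2 * S t \<omega>) (k - a))"
      by (simp add: m_def)
    then show ?thesis by (simp add: poisson_mass_convolution ring_distribs)
  qed
  define c where "c = lam1 + lam2"
  have c: "0 < c" using assms(2,3) by (simp add: c_def)
  \<comment> \<open>Partial sums of the Poisson generating series at \<open>1 - p\<close>. They
    increase to a limit at most 1, and this uniform bound lets the series be exchanged with the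
    expectation.\<close>
  define g where "g n x = (\<Sum>k<n. (1 - p) ^ k * poisson_mass (c * x) k)" for n x
  have g_lim: "(\<lambda>n. g n x) \<longlonglongrightarrow> exp (- (c * p * x))" for x
    using poisson_mass_generating[of "1 - p" "c * x"] by (simp add: g_def sums_def mult_ac)
  have g_bound: "\<bar>g n x\<bar> \<le> 1" if "0 \<le> x" for n x
  proof -
    have nn: "0 \<le> (1 - p) ^ k * poisson_mass (c * x) k" for k
      using bound[OF c that] \<open>p \<le> 1\<close> by simp
    have "incseq (\<lambda>n. g n x)"
      unfolding g_def by (intro incseq_SucI) (simp add: nn)
    then have "g n x \<le> exp (- (c * p * x))"
      by (rule incseq_le) (rule g_lim)
    also have "\<dots> \<le> 1" using c that \<open>0 < p\<close> by simp
    finally show ?thesis using nn by (simp add: g_def sum_nonneg)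
  qed
  have [measurable]: "g n \<in> borel_measurable borel" for n unfolding g_def by measurable
  have "(\<lambda>n. expectation (\<lambda>\<omega>. g n (S t \<omega>))) \<longlonglongrightarrow> expectation (\<lambda>\<omega>. exp (- (c * p * S t \<omega>)))"
    by (rule bounded_convergence[where B = 1]) (use g_lim g_bound nonneg in auto)
  moreover have "expectation (\<lambda>\<omega>. g n (S t \<omega>)) = (\<Sum>k<n. (1 - p) ^ k * (\<Sum>a=0..k. m a (k - a)))" for n
  proof -
    have "integrable M (\<lambda>\<omega>. poisson_mass (c * S t \<omega>) k)" for k
      by (rule integrable_const_bound[where B = 1]) (use nonneg bound[OF c] in auto)
    then show ?thesis by (simp add: g_def m_sum c_def)
  qed
  ultimately have "(\<lambda>k. (1 - p) ^ k * (\<Sum>a=0..k. m a (k - a))) sums expectation (\<lambda>\<omega>. exp (- (c * p * S t \<omega>)))"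
    by (simp add: sums_def)
  \<comment> \<open>The same series has been summed twice, once to the reliability and once to a
    Laplace transform of \<open>S t\<close>, so the two values agree.\<close>
  then have "reliability_function M T t = expectation (\<lambda>\<omega>. exp (- (c * p * S t \<omega>)))"
    using sums by (rule sums_unique2[symmetric])
  \<comment> \<open>The Laplace transform of the subordinator is evaluated at
    \<open>u = c * p\<close>.\<close>
  also have "\<dots> = exp (- (t * laplace_exponent \<eta> \<nu> (c * p)))"
    using c \<open>0 < p\<close> by (intro levy_subordinatorD(3)[OF S t]) simp
  finally have "reliability_function M T t = exp (- (t * laplace_exponent \<eta> \<nu> (c * p)))" .
  then show ?thesis
    using sums assms(11) by (simp add: shock c_def)
qed

end
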